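(* Let $ABC$ be a triangle whose circumcenter $P$ lies inside $\triangle ABC$. Let the cevians through $P$ be $AD$, $BE$, $CF$ with $D$ on $BC$, $E$ on $CA$, $F$ on $AB$, and let $r_1,\dots,r_6$ be the inradii of triangles $PBD$, $PDC$, $PCE$, $PEA$, $PAF$, $PFB$, respectively. Then $$\frac{1}{r_1}+\frac{1}{r_3}+\frac{1}{r_5}=\frac{1}{r_2}+\frac{1}{r_4}+\frac{1}{r_6}.$$
   Context: For a point $P$ inside $\triangle ABC$, line $AP$ meets side $BC$ at $D$, line $BP$ meets side $CA$ at $E$, and line $CP$ meets side $AB$ at $F$. The three cevians divide $\triangle ABC$ into six smaller triangles, numbered 1 to 6 in the order $PBD$, $PDC$, $PCE$, $PEA$, $PAF$, $PFB$; $r_i$ is the inradius of the $i$-th triangle. *)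

theory Defs
  imports "HOL-Analysis.Analysis"
begin

type_synonym point = "real ^ 2"

definition is_circumcenter :: "point \<Rightarrow> point \<Rightarrow> point \<Rightarrow> point \<Rightarrow> bool" where
  "is_circumcenter P A B C \<longleftrightarrow> (\<exists>R>0. {A, B, C} \<subseteq> sphere P R)"

text \<open>
  A circle is tangent to a line iff the distance from its centre to the line is its radius.
  Among the four circles tangent to all three side lines of a triangle, the incircle is the one
  whose centre is inside the triangle. For collinear points the interior is empty, so there is
  no incircle; otherwise it exists and is unique, and \<open>0 < r\<close> holds automatically because an
  interior point lies on no side line.
\<close>

definition is_incircle :: "point \<Rightarrow> real \<Rightarrow> point \<Rightarrow> point \<Rightarrow> point \<Rightarrow> bool" where
  "is_incircle I r A B C \<longleftrightarrow>
     I \<in> interior (convex hull {A, B, C}) \<and>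
     infdist I (affine hull {A, B}) = r \<and>
     infdist I (affine hull {B, C}) = r \<and>
     infdist I (affine hull {C, A}) = r"

definition inradius :: "point \<Rightarrow> point \<Rightarrow> point \<Rightarrow> real" where
  "inradius A B C = (THE r. \<exists>I. is_incircle I r A B C)"

end

theory Submission
  imports Defs
begin

text \<open>
  Let \<open>P = aA + bB + cC\<close> in barycentric coordinates, let \<open>R\<close> be the circumradius and \<open>T\<close> twice
  the area of \<open>ABC\<close>. The reciprocal of an inradius is the perimeter over twice the area.
  Since \<open>PB = PC = R\<close>, \<open>PD = aR / (b + c)\<close> and \<open>BD : DC = c : b\<close>, this gives
  \<open>1/r\<^sub>1 - 1/r\<^sub>2 = (b - c) R / (abcT)\<close>. The cyclic sum of \<open>b - c\<close> vanishes.
\<close>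

text \<open>The determinant of two plane vectors. On two edge vectors from a common vertex it is
  twice the signed area of the triangle, so areas can be handled as polynomials and absolute values
  taken only at the end.\<close>

definition cross2 :: "point \<Rightarrow> point \<Rightarrow> real" where
  "cross2 u v = u $ 1 * v $ 2 - u $ 2 * v $ 1"

lemma cross2_add_right: "cross2 u (v + w) = cross2 u v + cross2 u w"
  and cross2_diff_right: "cross2 u (v - w) = cross2 u v - cross2 u w"
  and cross2_scaleR_left: "cross2 (k *\<^sub>R u) v = k * cross2 u v"
  and cross2_scaleR_right: "cross2 u (k *\<^sub>R v) = k * cross2 u v"
  and cross2_self: "cross2 u u = 0"
  by (simp_all add: cross2_def algebra_simps)

lemma cross2_rotate: "cross2 (C - B) (A - B) = cross2 (B - A) (C - A)"
  by (simp add: cross2_def algebra_simps)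

text \<open>Lagrange's identity in the plane, in essence sin^2 + cos^2 = 1 for the angle between
  \<open>u\<close> and \<open>v\<close>.\<close>

lemma cross2_square_plus_inner_square:
  "(cross2 u v)\<^sup>2 + (u \<bullet> v)\<^sup>2 = (norm u)\<^sup>2 * (norm v)\<^sup>2"
  unfolding power2_norm_eq_inner
  by (simp add: cross2_def inner_vec_def sum_2 power2_eq_square algebra_simps)

lemma abs_cross2_le_norm: "\<bar>cross2 u v\<bar> \<le> norm u * norm v"
proof -
  have "(cross2 u v)\<^sup>2 \<le> (norm u * norm v)\<^sup>2"
    using cross2_square_plus_inner_square[of u v] zero_le_power2[of "u \<bullet> v"]
    unfolding power_mult_distrib by linarith
  then have "\<bar>cross2 u v\<bar> \<le> \<bar>norm u * norm v\<bar>"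
    by (rule abs_le_square_iff[THEN iffD2])
  then show ?thesis
    by simp
qed

text \<open>Collinearity is the equality case of Cauchy-Schwarz, and by Lagrange's identity the
  defect in that inequality is the square of \<open>cross2\<close>.\<close>

lemma collinear_iff_cross2_eq_0:
  "collinear {X, Y, Z} \<longleftrightarrow> cross2 (Y - X) (Z - X) = 0"
proof -
  have "collinear {X, Y, Z} \<longleftrightarrow> collinear {0, Y - X, Z - X}"
    using collinear_3[of Y X Z] by (simp add: insert_commute)
  also have "\<dots> \<longleftrightarrow> \<bar>(Y - X) \<bullet> (Z - X)\<bar> = norm (Y - X) * norm (Z - X)"
    by (simp add: norm_cauchy_schwarz_equal)
  also have "\<dots> \<longleftrightarrow> ((Y - X) \<bullet> (Z - X))\<^sup>2 = (norm (Y - X))\<^sup>2 * (norm (Z - X))\<^sup>2"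
    using power2_eq_iff_nonneg[of "\<bar>(Y - X) \<bullet> (Z - X)\<bar>" "norm (Y - X) * norm (Z - X)"]
    by (simp add: power_mult_distrib)
  also have "\<dots> \<longleftrightarrow> cross2 (Y - X) (Z - X) = 0"
    using cross2_square_plus_inner_square[of "Y - X" "Z - X"] by auto
  finally show ?thesis .
qed

text \<open>Area of a parallelogram divided by its base. Moving \<open>Z\<close> along the line does
  not change \<open>cross2 u (I - Z)\<close>, so \<open>abs_cross2_le_norm\<close> bounds every
  distance from below; the foot of the perpendicular attains the bound.\<close>

lemma infdist_line:
  fixes X Y I :: point
  assumes "X \<noteq> Y"
  shows "infdist I (affine hull {X, Y}) = \<bar>cross2 (Y - X) (I - X)\<bar> / dist X Y"
proof -
  define u where "u = Y - X"
  have u: "norm u > 0" "dist X Y = norm u"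
    using assms by (auto simp: u_def dist_norm norm_minus_commute)
  have ge: "\<bar>cross2 u (I - X)\<bar> / norm u \<le> dist I Z" if "Z \<in> affine hull {X, Y}" for Z
  proof -
    obtain t where Z: "Z = X + t *\<^sub>R u"
      using \<open>Z \<in> affine hull {X, Y}\<close> by (auto simp: affine_hull_2_alt u_def)
    have "cross2 u (I - X) = cross2 u (I - Z)"
      by (simp add: Z cross2_diff_right cross2_add_right cross2_scaleR_right cross2_self)
    then show ?thesis
      using abs_cross2_le_norm[of u "I - Z"] u
      by (simp add: divide_le_eq dist_norm mult.commute)
  qed
  \<comment> \<open>The parameter of the orthogonal projection of \<open>I\<close>; it makes the
    inner product in Lagrange's identity vanish.\<close>
  define t where "t = (u \<bullet> (I - X)) / (norm u)\<^sup>2"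
  define Z where "Z = X + t *\<^sub>R u"
  have Z: "Z \<in> affine hull {X, Y}"
    by (auto simp: affine_hull_2_alt u_def Z_def)
  have "cross2 u (I - X) = cross2 u (I - Z)"
    by (simp add: Z_def cross2_diff_right cross2_add_right cross2_scaleR_right cross2_self)
  moreover have "u \<bullet> (I - Z) = 0"
    using u by (simp add: Z_def t_def inner_diff_right inner_add_right power2_norm_eq_inner)
  ultimately have "(cross2 u (I - X))\<^sup>2 = (norm u * norm (I - Z))\<^sup>2"
    using cross2_square_plus_inner_square[of u "I - Z"] by (simp add: power_mult_distrib)
  then have "\<bar>cross2 u (I - X)\<bar> = \<bar>norm u * norm (I - Z)\<bar>"
    unfolding abs_eq_iff power2_eq_iff .
  then have "\<bar>cross2 u (I - X)\<bar> = norm u * norm (I - Z)"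
    by simp
  then have eq: "dist I Z = \<bar>cross2 u (I - X)\<bar> / norm u"
    using u by (simp add: dist_norm)
  have le: "dist I Z \<le> dist I W" if "W \<in> affine hull {X, Y}" for W
    using ge[OF that] eq by simp
  have "infdist I (affine hull {X, Y}) = dist I Z"
    using Z le infdist_notempty[of "affine hull {X, Y}" I] by (auto intro!: cInf_eq_minimum)
  then show ?thesis
    by (simp add: eq u flip: u_def)
qed

text \<open>In barycentric coordinates the distance to a side is the opposite coordinate times
  \<open>T\<close> over the side length. If all three distances equal \<open>r\<close>, clearing
  denominators and adding gives \<open>T = r * s\<close>, because the coordinates sum to 1.\<close>

lemma inradius_eq:
  assumes nc: "cross2 (Y - X) (Z - X) \<noteq> 0"
  shows "inradius X Y Z = \<bar>cross2 (Y - X) (Z - X)\<bar> / (dist X Y + dist Y Z + dist Z X)"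
proof -
  define T where "T = \<bar>cross2 (Y - X) (Z - X)\<bar>"
  define s where "s = dist X Y + dist Y Z + dist Z X"
  have T: "T > 0"
    using nc by (simp add: T_def)
  have ne: "X \<noteq> Y" "Y \<noteq> Z" "Z \<noteq> X"
    using nc by (auto simp: cross2_def)
  have s: "s > 0"
    using ne by (simp add: s_def add_pos_pos)
  have interior: "interior (convex hull {X, Y, Z})
      = {x *\<^sub>R X + y *\<^sub>R Y + z *\<^sub>R Z |x y z. 0 < x \<and> 0 < y \<and> 0 < z \<and> x + y + z = 1}"
    using interior_convex_hull_3_minimal[of X Y Z] nc
    by (auto simp: collinear_iff_cross2_eq_0)
  have dists: "infdist (x *\<^sub>R X + y *\<^sub>R Y + z *\<^sub>R Z) (affine hull {X, Y}) = z * T / dist X Y"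
      "infdist (x *\<^sub>R X + y *\<^sub>R Y + z *\<^sub>R Z) (affine hull {Y, Z}) = x * T / dist Y Z"
      "infdist (x *\<^sub>R X + y *\<^sub>R Y + z *\<^sub>R Z) (affine hull {Z, X}) = y * T / dist Z X"
    if "0 < x" "0 < y" "0 < z" "x + y + z = 1" for x y z
  proof -
    let ?I = "x *\<^sub>R X + y *\<^sub>R Y + z *\<^sub>R Z"
    have x: "x = 1 - y - z"
      using that by simp
    have "cross2 (Y - X) (?I - X) = z * cross2 (Y - X) (Z - X)"
      "cross2 (Z - Y) (?I - Y) = x * cross2 (Y - X) (Z - X)"
      "cross2 (X - Z) (?I - Z) = y * cross2 (Y - X) (Z - X)"
      by (simp_all add: x cross2_def algebra_simps)
    then show "infdist ?I (affine hull {X, Y}) = z * T / dist X Y"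
      "infdist ?I (affine hull {Y, Z}) = x * T / dist Y Z"
      "infdist ?I (affine hull {Z, X}) = y * T / dist Z X"
      using that ne by (simp_all add: infdist_line T_def abs_mult)
  qed
  \<comment> \<open>This equivalence supplies both the existence and the uniqueness that
    \<open>THE\<close> in \<open>inradius\<close> requires.\<close>
  have "(\<exists>I. is_incircle I r X Y Z) \<longleftrightarrow> r = T / s" for r
  proof
    assume "\<exists>I. is_incircle I r X Y Z"
    then obtain x y z where pos: "0 < x" "0 < y" "0 < z" and sum: "x + y + z = 1"
      and inc: "is_incircle (x *\<^sub>R X + y *\<^sub>R Y + z *\<^sub>R Z) r X Y Z"
      unfolding is_incircle_def interior by blast
    have "z * T = r * dist X Y" "x * T = r * dist Y Z" "y * T = r * dist Z X"
      using inc ne unfolding is_incircle_def dists[OF pos sum] by (auto simp: field_simps)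
    then have "(x + y + z) * T = r * s"
      by (simp add: s_def algebra_simps)
    then show "r = T / s"
      unfolding sum using s by (simp add: field_simps)
  next
    assume r: "r = T / s"
    \<comment> \<open>The incenter has the opposite side lengths as barycentric weights, normalised
      by the perimeter.\<close>
    let ?x = "dist Y Z / s" and ?y = "dist Z X / s" and ?z = "dist X Y / s"
    have pos: "0 < ?x" "0 < ?y" "0 < ?z"
      using ne s by simp_all
    have sum: "?x + ?y + ?z = 1"
      using s by (simp add: s_def add_divide_distrib[symmetric] add_ac)
    have "?x *\<^sub>R X + ?y *\<^sub>R Y + ?z *\<^sub>R Z \<in> interior (convex hull {X, Y, Z})"
      unfolding interior using pos sum by blast
    then have "is_incircle (?x *\<^sub>R X + ?y *\<^sub>R Y + ?z *\<^sub>R Z) r X Y Z"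
      unfolding is_incircle_def dists[OF pos sum] using ne r by simp
    then show "\<exists>I. is_incircle I r X Y Z" ..
  qed
  then show ?thesis
    by (simp add: inradius_def T_def s_def)
qed

text \<open>Writing \<open>D = A + t *\<^sub>R (P - A)\<close>, its barycentric coordinate at
  \<open>A\<close> is \<open>1 - t * (b + c)\<close>. This must vanish on the line
  \<open>BC\<close>, which determines \<open>t\<close>.\<close>

lemma cevian_foot_eq:
  assumes nc: "cross2 (B - A) (C - A) \<noteq> 0"
    and P: "P = a *\<^sub>R A + b *\<^sub>R B + c *\<^sub>R C" "a + b + c = 1" "b + c \<noteq> 0"
    and D: "D \<in> affine hull {A, P}" "D \<in> affine hull {B, C}"
  shows "(b + c) *\<^sub>R D = b *\<^sub>R B + c *\<^sub>R C"
proof -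
  obtain t where t: "D = A + t *\<^sub>R (P - A)"
    using D(1) by (auto simp: affine_hull_2_alt)
  obtain s where s: "D = B + s *\<^sub>R (C - B)"
    using D(2) by (auto simp: affine_hull_2_alt)
  have a: "a = 1 - b - c"
    using P(2) by simp
  have "cross2 (C - B) (D - B) = 0"
    by (simp add: s cross2_scaleR_right cross2_self)
  moreover have "cross2 (C - B) (D - B) = (1 - t * (b + c)) * cross2 (B - A) (C - A)"
    unfolding t P(1) a by (simp add: cross2_def algebra_simps)
  ultimately have "(b + c) * t = 1"
    using nc by (simp add: mult.commute)
  then have "(b + c) *\<^sub>R D = (b + c) *\<^sub>R A + (P - A)"
    by (simp add: t scaleR_add_right)
  then show ?thesis
    by (simp add: P(1) a algebra_simps)
qed

text \<open>Each reciprocal is a perimeter over a doubled area, and the common factor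
  \<open>1 / k\<close> cancels. The factor multiplying \<open>b - c\<close> is symmetric under
  cyclic relabelling, so the lemma can serve all three cevians.\<close>

lemma inverse_inradius_diff:
  assumes nc: "cross2 (B - A) (C - A) \<noteq> 0"
    and P: "P = a *\<^sub>R A + b *\<^sub>R B + c *\<^sub>R C" "a + b + c = 1" "a > 0" "b > 0" "c > 0"
    and R: "dist P A = R" "dist P B = R" "dist P C = R"
    and D: "D \<in> affine hull {A, P}" "D \<in> closed_segment B C"
  shows "1 / inradius P B D - 1 / inradius P D C
       = (b - c) * (R / (a * b * c * \<bar>cross2 (B - A) (C - A)\<bar>))"
proof -
  define T where "T = \<bar>cross2 (B - A) (C - A)\<bar>"
  define k where "k = b + c"
  define L where "L = dist B C"
  have T: "T > 0"
    using nc by (simp add: T_def)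
  have k: "k > 0" "k = 1 - a"
    using P by (simp_all add: k_def)
  have "D \<in> affine hull {B, C}"
    using D(2) by (metis convex_hull_subset_affine_hull segment_convex_hull subsetD)
  then have kD: "k *\<^sub>R D = b *\<^sub>R B + c *\<^sub>R C"
    using cevian_foot_eq[OF nc P(1,2) _ D(1)] k by (simp add: k_def)
  have kBD: "k *\<^sub>R (D - B) = c *\<^sub>R (C - B)" and kDC: "k *\<^sub>R (C - D) = b *\<^sub>R (C - B)"
    by (simp_all add: scaleR_diff_right kD) (simp_all add: k_def algebra_simps)
  \<comment> \<open>\<open>D\<close> lies beyond \<open>P\<close> on the ray from \<open>A\<close>.
    As \<open>PA\<close> is a circumradius, this yields \<open>PD\<close>, and
    \<open>PB + PD\<close> becomes \<open>R / k\<close> because \<open>k + a = 1\<close>.\<close>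
  have kPD: "k *\<^sub>R (D - P) = a *\<^sub>R (P - A)"
    using P(1) by (simp add: scaleR_diff_right kD) (simp add: k(2) algebra_simps)
  have norms: "k * dist B D = c * L" "k * dist D C = b * L" "k * dist D P = a * R"
    using arg_cong[OF kBD, of norm] arg_cong[OF kDC, of norm] arg_cong[OF kPD, of norm] P k R
    by (simp_all add: dist_norm norm_minus_commute L_def)
  have a: "a = 1 - b - c"
    using P(2) by simp
  \<comment> \<open>Scaling by \<open>k\<close> allows \<open>D\<close> to be eliminated through
    \<open>kPD\<close>, leaving polynomial identities in the coordinates of \<open>A\<close>,
    \<open>B\<close>, \<open>C\<close>.\<close>
  have "cross2 (B - P) (k *\<^sub>R (D - P)) = a * c * cross2 (B - A) (C - A)"
    "cross2 (k *\<^sub>R (D - P)) (C - P) = a * b * cross2 (B - A) (C - A)"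
    unfolding kPD unfolding P(1) a by (simp_all add: cross2_def algebra_simps)
  then have "k * cross2 (B - P) (D - P) = a * c * cross2 (B - A) (C - A)"
    "k * cross2 (D - P) (C - P) = a * b * cross2 (B - A) (C - A)"
    by (simp_all add: cross2_scaleR_left cross2_scaleR_right)
  then have areas: "cross2 (B - P) (D - P) = a * c * cross2 (B - A) (C - A) / k"
    "cross2 (D - P) (C - P) = a * b * cross2 (B - A) (C - A) / k"
    using k(1) by (simp_all add: field_simps)
  have lengths: "dist B D = c * L / k" "dist D C = b * L / k" "dist D P = a * R / k"
    using norms k(1) by (simp_all add: field_simps)
  have "1 / inradius P B D = (R + c * L / k + a * R / k) / (a * c * T / k)"
    using nc P(3-5) k(1) R
    by (subst inradius_eq) (simp_all add: areas lengths abs_mult T_def)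
  also have "\<dots> = ((k + a) * R + c * L) / (a * c * T)"
    using P(3-5) k(1) T by (simp add: field_simps)
  finally have 1: "1 / inradius P B D = (R + c * L) / (a * c * T)"
    by (simp add: k(2))
  have "1 / inradius P D C = (a * R / k + b * L / k + R) / (a * b * T / k)"
    using nc P(3-5) k(1) R
    by (subst inradius_eq) (simp_all add: areas lengths abs_mult T_def dist_commute[of C P] dist_commute[of P D])
  also have "\<dots> = ((k + a) * R + b * L) / (a * b * T)"
    using P(3-5) k(1) T by (simp add: field_simps)
  finally have 2: "1 / inradius P D C = (R + b * L) / (a * b * T)"
    by (simp add: k(2))
  \<comment> \<open>Over the common denominator both numerators contain \<open>b * c * L\<close>, so
    the side length \<open>BC\<close> drops out of the difference.\<close>
  have "(R + c * L) / (a * c * T) = (b * R + b * c * L) / (a * b * c * T)"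
    "(R + b * L) / (a * b * T) = (c * R + b * c * L) / (a * b * c * T)"
    using P(3-5) T by (simp_all add: frac_eq_eq) (simp_all add: algebra_simps)
  then show ?thesis
    unfolding 1 2 T_def[symmetric] by (simp add: diff_divide_distrib[symmetric] algebra_simps)
qed

theorem theorem5p1:
  fixes A B C P D E F :: point
  assumes "\<not> collinear {A, B, C}"
    and "is_circumcenter P A B C"
    and "P \<in> interior (convex hull {A, B, C})"
    and "D \<in> affine hull {A, P}" and "D \<in> closed_segment B C"
    and "E \<in> affine hull {B, P}" and "E \<in> closed_segment C A"
    and "F \<in> affine hull {C, P}" and "F \<in> closed_segment A B"
  shows "1 / inradius P B D + 1 / inradius P C E + 1 / inradius P A F
       = 1 / inradius P D C + 1 / inradius P E A + 1 / inradius P F B"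
proof -
  obtain R where R: "dist P A = R" "dist P B = R" "dist P C = R"
    using assms(2) by (auto simp: is_circumcenter_def)
  have "P \<in> {v. \<exists>x y z. 0 < x \<and> 0 < y \<and> 0 < z \<and> x + y + z = 1 \<and>
      x *\<^sub>R A + y *\<^sub>R B + z *\<^sub>R C = v}"
    using assms(3) interior_convex_hull_3_minimal[OF assms(1)] by simp
  then obtain a b c where pos: "a > 0" "b > 0" "c > 0" and sum: "a + b + c = 1"
    and P: "P = a *\<^sub>R A + b *\<^sub>R B + c *\<^sub>R C"
    by blast
  have P': "P = b *\<^sub>R B + c *\<^sub>R C + a *\<^sub>R A" "P = c *\<^sub>R C + a *\<^sub>R A + b *\<^sub>R B"
    and sum': "b + c + a = 1" "c + a + b = 1"
    using P sum by (simp_all add: add_ac)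
  \<comment> \<open>Here \<open>T\<close> keeps its sign; \<open>cross2_rotate\<close> shows that it
    is the same from every vertex in cyclic order.\<close>
  define T where "T = cross2 (B - A) (C - A)"
  have T: "cross2 (B - A) (C - A) = T" "cross2 (C - B) (A - B) = T" "cross2 (A - C) (B - C) = T"
    by (simp_all add: T_def cross2_rotate)
  have "T \<noteq> 0"
    using assms(1) by (simp add: T_def collinear_iff_cross2_eq_0)
  then have nc: "cross2 (B - A) (C - A) \<noteq> 0" "cross2 (C - B) (A - B) \<noteq> 0"
    "cross2 (A - C) (B - C) \<noteq> 0"
    by (simp_all add: T)
  \<comment> \<open>The cyclically invariant factor shared by the three differences, which are then
    \<open>b - c\<close>, \<open>c - a\<close> and \<open>a - b\<close> times
    \<open>K\<close>.\<close>
  define K where "K = R / (a * b * c * \<bar>T\<bar>)"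
  have K: "R / (b * c * a * \<bar>T\<bar>) = K" "R / (c * a * b * \<bar>T\<bar>) = K"
    by (simp_all add: K_def mult_ac)
  have "1 / inradius P B D - 1 / inradius P D C = (b - c) * K"
    using inverse_inradius_diff[OF nc(1) P sum pos R assms(4,5)] by (simp add: T K_def)
  moreover have "1 / inradius P C E - 1 / inradius P E A = (c - a) * K"
    using inverse_inradius_diff[OF nc(2) P'(1) sum'(1) pos(2,3,1) R(2,3,1) assms(6,7)]
    by (simp add: T K)
  moreover have "1 / inradius P A F - 1 / inradius P F B = (a - b) * K"
    using inverse_inradius_diff[OF nc(3) P'(2) sum'(2) pos(3,1,2) R(3,1,2) assms(8,9)]
    by (simp add: T K)
  ultimately show ?thesis
    by (simp add: algebra_simps)
qed

end
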